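(* The class $K^{LCC}$ is faithful: whenever $(\Gamma_1,X_1),(\Gamma_2,X_2)\in K^{LCC}$ and $\Phi\colon\Gamma_1\to\Gamma_2$ is an isomorphism of abstract groups, there exists a homeomorphism $\phi\colon X_1\to X_2$ such that $\Phi(\gamma)=\phi\circ\gamma\circ\phi^{-1}$ for every $\gamma\in\Gamma_1$.
   Context: A Boolean space is a Hausdorff space with a basis of compact open sets; a locally compact Cantor space is a non-empty second countable Boolean space without isolated points. $\operatorname{supp}(\phi)$ is the closure of $\{x:\phi(x)\neq x\}$; $\operatorname{Homeo}_c(X)$ is the set of homeomorphisms with compact open support. A space-group pair is $(\Gamma,X)$ with $X$ Boolean and $\Gamma\le\operatorname{Homeo}(X)$, $\Gamma\subseteq\operatorname{Homeo}_c(X)$. Such a pair is locally moving if every non-empty open $A\subseteq X$ admits $\gamma\in\Gamma\setminus\{1\}$ with $\operatorname{supp}(\gamma)\subseteq A$. An open set $B$ is flexible if for all open $C_1,C_2\subseteq B$: if some $\gamma\in\Gamma$ has $\gamma(C_1)\cap C_2\ne\emptyset$, then some $\tau\in\Gamma$ with $\operatorname{supp}(\tau)\subseteq B$ has $\tau(C_1)\cap C_2\ne\emptyset$. The pair is locally flexible if every non-empty open set contains a non-empty open flexible subset. A clopen $A\subseteq X$ is recognizable by $\Gamma$ if (1) for every $\gamma\in\Gamma$ with $\gamma(A)=A$, the homeomorphism equal to $\gamma$ on $A$ and the identity elsewhere lies in $\Gamma$; and (2) for every $\gamma\in\Gamma$ with $\gamma(A)\cap A=\emptyset$, the involution equal to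 $\gamma$ on $A$, to $\gamma^{-1}$ on $\gamma(A)$ and the identity elsewhere lies in $\Gamma$. The class $K^{LCC}$ consists of space-group pairs $(\Gamma,X)$ such that: (K1) $X$ is a locally compact Cantor space; (K2) $(\Gamma,X)$ is locally moving; (K3) $(\Gamma,X)$ is locally flexible; (K4) every clopen subset of $X$ is recognizable by $\Gamma$; (K5) the $\Gamma$-orbit of each point has at least $3$ points. *)

theory Defs
  imports "HOL-Analysis.Analysis"
begin

text \<open>Spaces are modelled as whole types of class topological_space: the space X is UNIV.\<close>

definition is_homeo :: "('a::topological_space \<Rightarrow> 'a) \<Rightarrow> bool" where
  "is_homeo f \<longleftrightarrow> (\<exists>g. homeomorphism UNIV UNIV f g)"

definition supp :: "('a::topological_space \<Rightarrow> 'a) \<Rightarrow> 'a set" where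
  "supp f = closure {x. f x \<noteq> x}"

definition boolean_space :: "'a::topological_space itself \<Rightarrow> bool" where
  "boolean_space _ \<longleftrightarrow>
     (\<forall>x y::'a. x \<noteq> y \<longrightarrow> (\<exists>U V. open U \<and> open V \<and> x \<in> U \<and> y \<in> V \<and> U \<inter> V = {})) \<and>
     (\<forall>U (x::'a). open U \<and> x \<in> U \<longrightarrow> (\<exists>V. compact V \<and> open V \<and> x \<in> V \<and> V \<subseteq> U))"

definition locally_compact_cantor :: "'a::topological_space itself \<Rightarrow> bool" where
  "locally_compact_cantor T \<longleftrightarrow>
     boolean_space T \<and> (UNIV :: 'a set) \<noteq> {} \<and>
     (\<exists>B :: 'a set set. countable B \<and> topological_basis B) \<and>
     (\<forall>x::'a. \<not> open {x})"

definition space_group_pair :: "('a::topological_space \<Rightarrow> 'a) set \<Rightarrow> bool" where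
  "space_group_pair G \<longleftrightarrow>
     boolean_space TYPE('a) \<and>
     id \<in> G \<and>
     (\<forall>f\<in>G. \<forall>g\<in>G. f \<circ> g \<in> G) \<and>
     (\<forall>f\<in>G. is_homeo f \<and> inv f \<in> G) \<and>
     (\<forall>f\<in>G. compact (supp f) \<and> open (supp f))"

definition locally_moving :: "('a::topological_space \<Rightarrow> 'a) set \<Rightarrow> bool" where
  "locally_moving G \<longleftrightarrow>
     (\<forall>A. open A \<and> A \<noteq> {} \<longrightarrow> (\<exists>\<gamma>\<in>G. \<gamma> \<noteq> id \<and> supp \<gamma> \<subseteq> A))"

definition flexible :: "('a::topological_space \<Rightarrow> 'a) set \<Rightarrow> 'a set \<Rightarrow> bool" where
  "flexible G B \<longleftrightarrow> open B \<and>
     (\<forall>C1 C2. open C1 \<and> C1 \<subseteq> B \<and> open C2 \<and> C2 \<subseteq> B \<longrightarrow>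
        (\<exists>\<gamma>\<in>G. \<gamma> ` C1 \<inter> C2 \<noteq> {}) \<longrightarrow>
        (\<exists>\<tau>\<in>G. supp \<tau> \<subseteq> B \<and> \<tau> ` C1 \<inter> C2 \<noteq> {}))"

definition locally_flexible :: "('a::topological_space \<Rightarrow> 'a) set \<Rightarrow> bool" where
  "locally_flexible G \<longleftrightarrow>
     (\<forall>A. open A \<and> A \<noteq> {} \<longrightarrow> (\<exists>B. B \<subseteq> A \<and> B \<noteq> {} \<and> flexible G B))"

definition recognizable :: "('a::topological_space \<Rightarrow> 'a) set \<Rightarrow> 'a set \<Rightarrow> bool" where
  "recognizable G A \<longleftrightarrow>
     (\<forall>\<gamma>\<in>G. \<gamma> ` A = A \<longrightarrow> (\<lambda>x. if x \<in> A then \<gamma> x else x) \<in> G) \<and>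
     (\<forall>\<gamma>\<in>G. \<gamma> ` A \<inter> A = {} \<longrightarrow>
        (\<lambda>x. if x \<in> A then \<gamma> x else if x \<in> \<gamma> ` A then inv \<gamma> x else x) \<in> G)"

definition orbit :: "('a \<Rightarrow> 'a) set \<Rightarrow> 'a \<Rightarrow> 'a set" where
  "orbit G x = {\<gamma> x | \<gamma>. \<gamma> \<in> G}"

definition K_LCC :: "('a::topological_space \<Rightarrow> 'a) set \<Rightarrow> bool" where
  "K_LCC G \<longleftrightarrow>
     space_group_pair G \<and>
     locally_compact_cantor TYPE('a) \<and>
     locally_moving G \<and>
     locally_flexible G \<and>
     (\<forall>A::'a set. open A \<and> closed A \<longrightarrow> recognizable G A) \<and>
     (\<forall>x. \<exists>y1 y2 y3. y1 \<in> orbit G x \<and> y2 \<in> orbit G x \<and> y3 \<in> orbit G x \<and>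
                      y1 \<noteq> y2 \<and> y1 \<noteq> y3 \<and> y2 \<noteq> y3)"

end

theory Submission
  imports Defs
begin

text \<open>
  As in Fremlin's treatment of groups with many involutions, the relation
  \<open>supp \<phi> \<subseteq> supp \<pi>\<close>, for an involution \<open>\<pi>\<close>, is
  expressed by centralizers alone. Let \<open>U\<close> be the set of involutive elements of the centralizer
  \<open>C(\<pi>)\<close> that commute with all their \<open>C(\<pi>)\<close>-conjugates. They are supported in
  \<open>supp \<pi>\<close>, and by recognizability the restrictions of \<open>\<pi>\<close> to
  \<open>\<pi>\<close>-invariant clopen sets are among them; so an element \<open>\<phi>\<close> of the centralizer of
  \<open>U\<close> satisfies \<open>\<phi> x \<in> {x, \<pi> x}\<close> whenever \<open>\<pi> x \<noteq> x\<close>, and its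
  square is trivial on \<open>supp \<pi>\<close>. The centralizer of these squares is
  \<open>{\<phi>. supp \<phi> \<subseteq> supp \<pi>}\<close>. Hence an isomorphism preserves inclusion and
  disjointness of the (compact open) supports of involutions. As orbits have at least three points,
  intersections of two such supports form a basis, so a point is determined by the involutions whose
  support contains it, and compactness yields the corresponding point of the other space.
\<close>

section \<open>Homeomorphisms and supports\<close>

lemma is_homeo_bij: "is_homeo f \<Longrightarrow> bij f"
  unfolding is_homeo_def homeomorphism_def by (metis UNIV_I bij_iff)

lemma is_homeo_continuous: "is_homeo f \<Longrightarrow> continuous_on UNIV f"
  unfolding is_homeo_def homeomorphism_def by blast

lemma is_homeo_open_image:
  assumes "is_homeo f" "open A" shows "open (f ` A)"
proof -
  obtain g where g: "homeomorphism UNIV UNIV f g" using assms unfolding is_homeo_def by blast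
  then have "f ` A = g -` A" unfolding homeomorphism_def by (auto simp: image_iff) (metis UNIV_I)
  moreover have "open (g -` A)"
    using g assms(2) by (simp add: homeomorphism_def continuous_on_open_vimage)
  ultimately show ?thesis by simp
qed

lemma is_homeo_compact_image: "is_homeo f \<Longrightarrow> compact A \<Longrightarrow> compact (f ` A)"
  by (meson compact_continuous_image continuous_on_subset is_homeo_continuous subset_UNIV)

lemma open_disjoint_supp_iff: "open A \<Longrightarrow> A \<inter> supp f = {} \<longleftrightarrow> (\<forall>x\<in>A. f x = x)"
  unfolding supp_def by (auto simp: open_Int_closure_eq_empty)

lemma moved_in_supp: "f x \<noteq> x \<Longrightarrow> x \<in> supp f"
  unfolding supp_def using closure_subset by fastforce

lemma closed_supp: "closed (supp f)"
  by (simp add: supp_def)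

lemma supp_nonempty: "f \<noteq> id \<Longrightarrow> supp f \<noteq> {}"
  by (metis emptyE eq_id_iff moved_in_supp)

lemma supp_subset_iff: "closed S \<Longrightarrow> supp f \<subseteq> S \<longleftrightarrow> (\<forall>x. f x \<noteq> x \<longrightarrow> x \<in> S)"
  (is "?S \<Longrightarrow> ?L \<longleftrightarrow> ?R")
proof
  show ?R if ?L using that moved_in_supp[of f] by (meson subsetD)
  show ?L if ?S ?R using that unfolding supp_def by (intro closure_minimal) auto
qed

text \<open>By injectivity a point moved by one map is sent to a point that this map also moves; the
  other map therefore fixes both.\<close>

lemma disjoint_moved_commute:
  assumes "inj f" "inj g" "\<And>x. f x = x \<or> g x = x"
  shows "f \<circ> g = g \<circ> f"
proof
  fix x
  show "(f \<circ> g) x = (g \<circ> f) x"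
    using assms by (metis comp_apply injD)
qed

text \<open>The homeomorphism \<open>g\<close> carries the points moved by the conjugate onto those
  moved by \<open>f\<close>, hence also their closures.\<close>

lemma supp_conjugate_mem:
  assumes "is_homeo g"
  shows "x \<in> supp (inv g \<circ> f \<circ> g) \<longleftrightarrow> g x \<in> supp f"
proof -
  have b: "bij g" by (rule is_homeo_bij[OF assms])
  have eq: "(inv g \<circ> f \<circ> g) y \<noteq> y \<longleftrightarrow> f (g y) \<noteq> g y" for y
    using b by (metis bij_inv_eq_iff comp_apply)
  show ?thesis
  proof
    assume "x \<in> supp (inv g \<circ> f \<circ> g)"
    then have x: "x \<in> closure {y. f (g y) \<noteq> g y}" unfolding supp_def eq .
    have "closed (g -` supp f)"
      using is_homeo_continuous[OF assms] closed_supp continuous_closed_vimage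
      by (metis UNIV_I closed_vimage continuous_on_eq_continuous_within)
    moreover have "{y. f (g y) \<noteq> g y} \<subseteq> g -` supp f" using moved_in_supp[of f] by auto
    ultimately show "g x \<in> supp f" using x closure_minimal by blast
  next
    assume gx: "g x \<in> supp f"
    show "x \<in> supp (inv g \<circ> f \<circ> g)"
    proof (rule ccontr)
      let ?A = "- supp (inv g \<circ> f \<circ> g)"
      assume "x \<notin> supp (inv g \<circ> f \<circ> g)"
      then have "g x \<in> g ` ?A" by simp
      moreover have "open (g ` ?A)" by (simp add: assms is_homeo_open_image closed_supp open_Compl)
      moreover have "f (g y) = g y" if "y \<in> ?A" for y
        using that eq[of y] moved_in_supp[of "inv g \<circ> f \<circ> g" y] by (meson ComplD)
      then have "\<forall>y\<in>g ` ?A. f y = y" by blast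
      ultimately show False using gx open_disjoint_supp_iff by blast
    qed
  qed
qed

section \<open>Centralizers and supports of involutions\<close>

definition centralizer :: "('a \<Rightarrow> 'a) set \<Rightarrow> ('a \<Rightarrow> 'a) set \<Rightarrow> ('a \<Rightarrow> 'a) set" where
  "centralizer G S = {f \<in> G. \<forall>g\<in>S. f \<circ> g = g \<circ> f}"

definition self_commuting_involutions :: "('a \<Rightarrow> 'a) set \<Rightarrow> ('a \<Rightarrow> 'a) \<Rightarrow> ('a \<Rightarrow> 'a) set" where
  "self_commuting_involutions G p = {f \<in> centralizer G {p}. f \<circ> f = id \<and>
     (\<forall>g\<in>centralizer G {p}. f \<circ> (g \<circ> f \<circ> inv g) = (g \<circ> f \<circ> inv g) \<circ> f)}"

text \<open>Built from commutation and squaring alone, so it is preserved by group isomorphisms. For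
  an involution \<open>p\<close> in \<open>G\<close> it turns out to be the rigid stabilizer of
  \<open>supp p\<close>.\<close>

definition support_group :: "('a \<Rightarrow> 'a) set \<Rightarrow> ('a \<Rightarrow> 'a) \<Rightarrow> ('a \<Rightarrow> 'a) set" where
  "support_group G p =
     centralizer G ((\<lambda>f. f \<circ> f) ` centralizer G (self_commuting_involutions G p))"

locale K_LCC_group =
  fixes G :: "('a::topological_space \<Rightarrow> 'a) set"
  assumes K: "K_LCC G"
begin

section \<open>Separation and compactness in the space\<close>

lemma boolean: "boolean_space TYPE('a)"
  and id_in: "id \<in> G"
  and comp_in: "f \<in> G \<Longrightarrow> g \<in> G \<Longrightarrow> f \<circ> g \<in> G"
  and homeo: "f \<in> G \<Longrightarrow> is_homeo f"
  and inv_in: "f \<in> G \<Longrightarrow> inv f \<in> G"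
  and compact_supp: "f \<in> G \<Longrightarrow> compact (supp f)"
  and open_supp: "f \<in> G \<Longrightarrow> open (supp f)"
  and moving: "open A \<Longrightarrow> A \<noteq> {} \<Longrightarrow> \<exists>f\<in>G. f \<noteq> id \<and> supp f \<subseteq> A"
  and recognizable: "open A \<Longrightarrow> closed A \<Longrightarrow> recognizable G A"
  using K unfolding K_LCC_def space_group_pair_def locally_moving_def by auto

lemma G_bij: "f \<in> G \<Longrightarrow> bij f"
  using homeo is_homeo_bij by blast

lemma G_inj: "f \<in> G \<Longrightarrow> inj f"
  using G_bij bij_is_inj by blast

lemma separation:
  "x \<noteq> y \<Longrightarrow> \<exists>U V. open U \<and> open V \<and> x \<in> U \<and> y \<in> V \<and> U \<inter> V = {}" for x y :: 'a
  using boolean unfolding boolean_space_def by blast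

lemma compact_open_base:
  "open U \<Longrightarrow> x \<in> U \<Longrightarrow> \<exists>V. compact V \<and> open V \<and> x \<in> V \<and> V \<subseteq> U" for x :: 'a
  using boolean unfolding boolean_space_def by blast

text \<open>Separation is an assumption of the locale, not of the type class, so closedness of
  compact sets is taken from abstract topologies.\<close>

lemma hausdorff: "Hausdorff_space (euclidean :: 'a topology)"
  unfolding Hausdorff_space_def disjnt_def using separation by auto

lemma compact_closed: "compact A \<Longrightarrow> closed A" for A :: "'a set"
  using compactin_imp_closedin[OF hausdorff, of A] by simp

lemma open_avoiding: "open (- {x})" for x :: 'a
  using compact_closed[of "{x}"] by (simp add: open_Compl)

lemma closed_eq:
  fixes f g :: "'a \<Rightarrow> 'a"
  assumes "continuous_on UNIV f" "continuous_on UNIV g"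
  shows "closed {x. f x = g x}"
proof -
  have "open {x. f x \<noteq> g x}"
  proof (rule iffD2[OF open_subopen], intro ballI)
    fix x assume "x \<in> {x. f x \<noteq> g x}"
    then obtain U V where UV: "open U" "open V" "f x \<in> U" "g x \<in> V" "U \<inter> V = {}"
      using separation[of "f x" "g x"] by blast
    have "open (f -` U \<inter> g -` V)"
      using UV(1,2) assms by (simp add: continuous_on_open_vimage open_Int)
    then show "\<exists>T. open T \<and> x \<in> T \<and> T \<subseteq> {x. f x \<noteq> g x}"
      using UV by (intro exI[of _ "f -` U \<inter> g -` V"]) auto
  qed
  then show ?thesis by (simp add: closed_def Compl_eq)
qed

lemma small_disjoint_image:
  assumes "f \<in> G" "f x \<noteq> x" "open U" "x \<in> U"
  shows "\<exists>A. compact A \<and> open A \<and> x \<in> A \<and> A \<subseteq> U \<and> f ` A \<inter> A = {}"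
proof -
  obtain V W where VW: "open V" "open W" "f x \<in> V" "x \<in> W" "V \<inter> W = {}"
    using separation[OF assms(2)] by blast
  have "open (U \<inter> W \<inter> f -` V)"
    using VW assms homeo is_homeo_continuous
    by (metis continuous_on_open_vimage inf_top.right_neutral open_Int open_UNIV)
  then obtain A where "compact A" "open A" "x \<in> A" "A \<subseteq> U \<inter> W \<inter> f -` V"
    using compact_open_base[of "U \<inter> W \<inter> f -` V" x] VW assms(4) by auto
  then show ?thesis using VW(5) by (intro exI[of _ A]) auto
qed

section \<open>Elements obtained from recognizability and local movement\<close>

definition swap_on :: "('a \<Rightarrow> 'a) \<Rightarrow> 'a set \<Rightarrow> 'a \<Rightarrow> 'a" where
  "swap_on f A = (\<lambda>x. if x \<in> A then f x else if x \<in> f ` A then inv f x else x)"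

lemma swap_on:
  assumes "f \<in> G" "compact A" "open A" "f ` A \<inter> A = {}"
  shows "swap_on f A \<in> G" "swap_on f A \<circ> swap_on f A = id" "supp (swap_on f A) = A \<union> f ` A"
    and "\<And>x. x \<in> A \<Longrightarrow> swap_on f A x = f x"
proof -
  show "swap_on f A \<in> G"
    using recognizable[OF assms(3) compact_closed[OF assms(2)]] assms(1,4)
    unfolding recognizable_def swap_on_def by blast
  have i: "inj f" by (rule G_inj[OF assms(1)])
  show "swap_on f A \<circ> swap_on f A = id"
    using assms(4) i by (auto simp: swap_on_def fun_eq_iff)
  have "{x. swap_on f A x \<noteq> x} = A \<union> f ` A"
    using assms(4) i by (auto simp: swap_on_def)
  \<comment> \<open>The set of moved points is already closed, so the support adds nothing to
    it.\<close>
  moreover have "closed (A \<union> f ` A)"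
    using assms(1,2) by (intro closed_Un compact_closed is_homeo_compact_image homeo)
  ultimately show "supp (swap_on f A) = A \<union> f ` A"
    unfolding supp_def by (simp only: closure_closed)
qed (simp add: swap_on_def)

text \<open>Local movement supplies some \<open>f\<close> supported in \<open>A\<close>; exchanging
  a small piece \<open>B\<close> with its image under \<open>f\<close> turns it into an involution.
  The displaced set \<open>B\<close> is recorded for the construction of elements with nontrivial
  square.\<close>

lemma involution_inside:
  assumes "open A" "A \<noteq> {}"
  shows "\<exists>s\<in>G. s \<circ> s = id \<and> s \<noteq> id \<and> supp s \<subseteq> A \<and>
           (\<exists>B. open B \<and> B \<noteq> {} \<and> B \<subseteq> A \<and> s ` B \<inter> B = {})"
proof -
  obtain f where f: "f \<in> G" "f \<noteq> id" "supp f \<subseteq> A" using moving assms by blast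
  then obtain x where x: "f x \<noteq> x" by (auto simp: fun_eq_iff)
  then obtain B where B: "compact B" "open B" "x \<in> B" "B \<subseteq> supp f" "f ` B \<inter> B = {}"
    using small_disjoint_image[OF f(1) x open_supp[OF f(1)] moved_in_supp[of f, OF x]] by blast
  \<comment> \<open>Since \<open>f\<close> moves every point of \<open>B\<close>, it also moves
    every point of its image, so the swap stays within \<open>supp f\<close>.\<close>
  have "f y \<noteq> y" if "y \<in> B" for y using that B(5) by force
  then have "f (f y) \<noteq> f y" if "y \<in> B" for y using that G_inj[OF f(1)] by (metis injD)
  then have "f ` B \<subseteq> supp f" using moved_in_supp[of f] by blast
  note s = swap_on[OF f(1) B(1,2,5)]
  show ?thesis
  proof (intro bexI[of _ "swap_on f B"] conjI exI[of _ B])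
    show "supp (swap_on f B) \<subseteq> A" using s(3) \<open>f ` B \<subseteq> supp f\<close> B(4) f(3) by blast
    show "swap_on f B \<noteq> id" using s(4) x B(3) by (metis id_apply)
    show "swap_on f B ` B \<inter> B = {}" using s(4) B(5) by auto
  qed (use s B f in auto)
qed

text \<open>Take an involution \<open>s\<close> displacing \<open>B\<close> and a nontrivial
  \<open>g\<close> supported in \<open>B\<close>. On a point moved by \<open>g\<close>, the square
  of \<open>s \<circ> g\<close> acts as \<open>g\<close>, because the second \<open>g\<close> meets
  a point outside \<open>B\<close>. Such elements are the test elements of the centralizer
  arguments.\<close>

lemma nontrivial_square_inside:
  assumes "open A" "A \<noteq> {}"
  shows "\<exists>f\<in>G. f \<circ> f \<noteq> id \<and> supp f \<subseteq> A"
proof -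
  obtain s B where s: "s \<in> G" "s \<circ> s = id" "supp s \<subseteq> A"
    and B: "open B" "B \<noteq> {}" "B \<subseteq> A" "s ` B \<inter> B = {}"
    using involution_inside[OF assms] by blast
  obtain g where g: "g \<in> G" "g \<noteq> id" "supp g \<subseteq> B" using moving B by blast
  then obtain x where x: "g x \<noteq> x" by (auto simp: fun_eq_iff)
  then have "g (g x) \<noteq> g x" using G_inj[OF g(1)] by (metis injD)
  then have "g x \<in> B" using g(3) moved_in_supp[of g "g x"] by blast
  then have "s (g x) \<notin> B" using B(4) by blast
  then have "g (s (g x)) = s (g x)" using g(3) moved_in_supp[of g "s (g x)"] by blast
  then have "((s \<circ> g) \<circ> (s \<circ> g)) x = g x"
    using s(2) by (simp add: fun_eq_iff)
  then have "(s \<circ> g) \<circ> (s \<circ> g) \<noteq> id" using x by (metis id_apply)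
  moreover have "y \<in> supp s \<union> supp g" if "(s \<circ> g) y \<noteq> y" for y
    using that moved_in_supp[of s y] moved_in_supp[of g y] by (cases "g y = y") auto
  then have "{y. (s \<circ> g) y \<noteq> y} \<subseteq> supp s \<union> supp g" by blast
  then have "supp (s \<circ> g) \<subseteq> supp s \<union> supp g"
    unfolding supp_def[of "s \<circ> g"] by (intro closure_minimal closed_Un closed_supp)
  ultimately show ?thesis
    using s(1,3) g(1,3) B(3) comp_in by (intro bexI[of _ "s \<circ> g"]) auto
qed

section \<open>Support inclusion expressed by centralizers\<close>

text \<open>If \<open>f\<close> displaces an open set \<open>A\<close> off \<open>supp p\<close>,
  every \<open>g\<close> supported in \<open>A\<close> centralizes \<open>p\<close>. Commutation of
  \<open>f\<close> with its conjugate by \<open>g\<close> then forces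
  \<open>g \<circ> g = id\<close>, against the choice of \<open>g\<close>.\<close>

lemma self_commuting_supp:
  assumes p: "p \<in> G" and f: "f \<in> self_commuting_involutions G p"
  shows "supp f \<subseteq> supp p"
proof (rule ccontr)
  have fG: "f \<in> G" and ff: "\<And>x. f (f x) = x"
    using f by (auto simp: self_commuting_involutions_def centralizer_def fun_eq_iff)
  assume "\<not> supp f \<subseteq> supp p"
  then obtain x where x: "f x \<noteq> x" "x \<in> - supp p" using supp_subset_iff[OF closed_supp] by blast
  then obtain A where A: "open A" "x \<in> A" "A \<subseteq> - supp p" "f ` A \<inter> A = {}"
    using small_disjoint_image[OF fG x(1) open_Compl[OF closed_supp] x(2)] by blast
  then obtain g where g: "g \<in> G" "g \<circ> g \<noteq> id" "supp g \<subseteq> A"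
    using nontrivial_square_inside by blast
  have "g \<circ> p = p \<circ> g"
  proof (rule disjoint_moved_commute)
    show "g x = x \<or> p x = x" for x
      using moved_in_supp[of g x] moved_in_supp[of p x] g(3) A(3) by blast
  qed (use g p G_inj in auto)
  then have "g \<in> centralizer G {p}" using g by (simp add: centralizer_def)
  then have comm: "f (g (f (inv g y))) = g (f (inv g (f y)))" for y
    using f by (auto simp: self_commuting_involutions_def fun_eq_iff)
  have ginv: "inv g (g y) = y" "g (inv g y) = y" for y
    using G_bij[OF g(1)] by (auto simp: bij_is_inj bij_is_surj surj_f_inv_f)
  have fix_out: "g y = y" if "y \<notin> A" for y using that g(3) moved_in_supp[of g y] by blast
  then have fix_out': "inv g y = y" if "y \<notin> A" for y using that ginv by metis
  have A_inv: "g y \<in> A" if "y \<in> A" for y using that fix_out' ginv(1) by metis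
  have "g (g y) = y" for y
  proof (cases "y \<in> A")
    case True
    have "f y \<notin> A" using True A(4) by blast
    have "f (g y) \<notin> A" using True A(4) A_inv by blast
    \<comment> \<open>Both sides of \<open>comm\<close> are evaluated at \<open>g y\<close>: one
      collapses to \<open>y\<close>, the other to \<open>g (g y)\<close>.\<close>
    have "f (g (f (inv g (g y)))) = y" using fix_out \<open>f y \<notin> A\<close> by (simp add: ginv ff)
    moreover have "g (f (inv g (f (g y)))) = g (g y)"
      using fix_out' \<open>f (g y) \<notin> A\<close> by (simp add: ff)
    ultimately show ?thesis using comm by metis
  qed (simp add: fix_out)
  then show False using g(2) by (auto simp: fun_eq_iff)
qed

text \<open>An element commuting with \<open>p\<close> conjugates a restriction of \<open>p\<close>
  to another restriction of \<open>p\<close>, and restrictions of \<open>p\<close> to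
  \<open>p\<close>-invariant sets commute with each other.\<close>

lemma restriction_self_commuting:
  assumes p: "p \<in> G" "p \<circ> p = id" and A: "compact A" "open A"
    and B: "B = A \<union> p ` A"
  shows "(\<lambda>x. if x \<in> B then p x else x) \<in> self_commuting_involutions G p"
    (is "?f \<in> _")
proof -
  have pp: "p (p x) = x" for x using p(2) by (simp add: fun_eq_iff)
  have pB: "p x \<in> B \<longleftrightarrow> x \<in> B" for x
    unfolding B using pp by (auto simp: image_iff) metis+
  have "p ` B = B" unfolding B by (auto simp: image_Un image_image pp)
  moreover have "open B" "closed B"
    unfolding B using A p(1) by (auto intro!: open_Un closed_Un compact_closed
        is_homeo_open_image is_homeo_compact_image homeo)
  ultimately have fG: "?f \<in> G"
    using recognizable[of B] p(1) unfolding recognizable_def by blast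
  have "?f \<circ> p = p \<circ> ?f" by (auto simp: pB)
  moreover have "?f \<circ> ?f = id" by (auto simp: pB pp)
  moreover have "?f \<circ> (g \<circ> ?f \<circ> inv g) = (g \<circ> ?f \<circ> inv g) \<circ> ?f" if g: "g \<in> centralizer G {p}" for g
  proof -
    have gG: "g \<in> G" and gp: "g (p x) = p (g x)" for x
      using g by (auto simp: centralizer_def fun_eq_iff)
    have gi: "inv g (g x) = x" "g (inv g x) = x" for x
      using G_bij[OF gG] by (auto simp: bij_is_inj bij_is_surj surj_f_inv_f)
    have igp: "inv g (p x) = p (inv g x)" for x by (metis gi gp)
    have "g \<circ> ?f \<circ> inv g = (\<lambda>x. if inv g x \<in> B then p x else x)"
      by (auto simp: gp gi)
    then show ?thesis by (auto simp: pB igp)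
  qed
  ultimately show ?thesis
    using fG by (simp add: self_commuting_involutions_def centralizer_def)
qed

text \<open>Commuting with the restrictions of \<open>p\<close> to small invariant neighbourhoods
  leaves \<open>x\<close> and \<open>p x\<close> as the only possible values of \<open>f x\<close>
  where \<open>p\<close> moves \<open>x\<close>.\<close>

lemma square_fixes_supp:
  assumes p: "p \<in> G" "p \<circ> p = id" and f: "f \<in> centralizer G (self_commuting_involutions G p)"
    and x: "x \<in> supp p"
  shows "f (f x) = x"
proof -
  have fG: "f \<in> G" using f by (simp add: centralizer_def)
  have fi: "inj f" by (rule G_inj[OF fG])
  have pp: "p (p x) = x" for x using p(2) by (simp add: fun_eq_iff)
  have two: "f x = x \<or> f x = p x" if x: "p x \<noteq> x" for x
  proof (rule ccontr)
    assume n: "\<not> (f x = x \<or> f x = p x)"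
    \<comment> \<open>The neighbourhood is chosen so that neither it nor its image under
      \<open>p\<close> contains \<open>f x\<close>; the restriction \<open>?r\<close> then moves
      \<open>x\<close> but fixes \<open>f x\<close>.\<close>
    have "open (- {f x} \<inter> p -` (- {f x}))"
      using open_avoiding homeo[OF p(1)] is_homeo_continuous
      by (metis continuous_on_open_vimage inf_top.right_neutral open_Int open_UNIV)
    then obtain A where A: "compact A" "open A" "x \<in> A" "A \<subseteq> - {f x} \<inter> p -` (- {f x})"
      using compact_open_base[of "- {f x} \<inter> p -` (- {f x})" x] n by auto
    define B where "B = A \<union> p ` A"
    have "f x \<notin> B" using A(4) unfolding B_def by auto
    let ?r = "\<lambda>x. if x \<in> B then p x else x"
    have "?r \<in> self_commuting_involutions G p"
      by (rule restriction_self_commuting[OF p A(1,2) B_def])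
    then have "f \<circ> ?r = ?r \<circ> f" using f unfolding centralizer_def by blast
    then have "f (?r x) = ?r (f x)" by (rule comp_eq_dest)
    moreover have "x \<in> B" using A(3) B_def by blast
    ultimately have "f (p x) = f x" using \<open>f x \<notin> B\<close> by simp
    then show False using fi x by (metis injD)
  qed
  \<comment> \<open>If \<open>f x = p x\<close>, then \<open>f (p x)\<close> is \<open>p x\<close>
    or \<open>x\<close>, and injectivity excludes \<open>p x\<close>.\<close>
  have "f (f x) = x" if x: "p x \<noteq> x" for x
    using two[of x] two[of "p x"] x pp fi by (metis injD)
  then have "{x. p x \<noteq> x} \<subseteq> {x. (f \<circ> f) x = id x}" by auto
  \<comment> \<open>\<open>supp p\<close> may contain limit points fixed by \<open>p\<close>; these
    are reached because the equalizer is closed.\<close>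
  moreover have "closed {x. (f \<circ> f) x = id x}"
    using is_homeo_continuous[OF homeo[OF comp_in[OF fG fG]]] by (intro closed_eq) auto
  ultimately have "supp p \<subseteq> {x. (f \<circ> f) x = id x}"
    unfolding supp_def by (rule closure_minimal)
  then show ?thesis using x by auto
qed

lemma disjoint_supp_centralizes:
  assumes "p \<in> G" "g \<in> G" "supp g \<inter> supp p = {}"
  shows "g \<in> centralizer G (self_commuting_involutions G p)"
proof -
  have "g \<circ> f = f \<circ> g" if f: "f \<in> self_commuting_involutions G p" for f
  proof (rule disjoint_moved_commute)
    show "inj f" using f G_inj by (auto simp: self_commuting_involutions_def centralizer_def)
    show "g x = x \<or> f x = x" for x
      using self_commuting_supp[OF assms(1) f] assms(3) moved_in_supp[of g x]
        moved_in_supp[of f x] by blast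
  qed (use assms(2) G_inj in auto)
  then show ?thesis using assms(2) by (simp add: centralizer_def)
qed

text \<open>The squares fix \<open>supp p\<close> pointwise, so they commute with anything supported
  there. Conversely, an \<open>f\<close> moving a point off \<open>supp p\<close> displaces a small
  set \<open>A\<close> there, and fails to commute with a nontrivial square supported in
  \<open>A\<close>.\<close>

lemma support_group_iff:
  assumes p: "p \<in> G" "p \<circ> p = id" and f: "f \<in> G"
  shows "f \<in> support_group G p \<longleftrightarrow> supp f \<subseteq> supp p"
proof
  assume sub: "supp f \<subseteq> supp p"
  have "f \<circ> (g \<circ> g) = (g \<circ> g) \<circ> f"
    if g: "g \<in> centralizer G (self_commuting_involutions G p)" for g
  proof (rule disjoint_moved_commute)
    have "g \<in> G" using g by (simp add: centralizer_def)
    then show "inj (g \<circ> g)" using comp_in G_inj by blast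
    show "f x = x \<or> (g \<circ> g) x = x" for x
      using square_fixes_supp[OF p g, of x] sub moved_in_supp[of f x] by auto
  qed (use f G_inj in auto)
  then show "f \<in> support_group G p" using f by (auto simp: support_group_def centralizer_def)
next
  assume fs: "f \<in> support_group G p"
  show "supp f \<subseteq> supp p"
  proof (rule ccontr)
    assume "\<not> supp f \<subseteq> supp p"
    then obtain x where x: "f x \<noteq> x" "x \<in> - supp p"
      using supp_subset_iff[OF closed_supp] by blast
    then obtain A where A: "open A" "x \<in> A" "A \<subseteq> - supp p" "f ` A \<inter> A = {}"
      using small_disjoint_image[OF f x(1) open_Compl[OF closed_supp] x(2)] by blast
    then obtain g where g: "g \<in> G" "g \<circ> g \<noteq> id" "supp g \<subseteq> A"
      using nontrivial_square_inside by blast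
    have "g \<in> centralizer G (self_commuting_involutions G p)"
      using disjoint_supp_centralizes[OF p(1) g(1)] g(3) A(3) by blast
    then have comm: "f (g (g y)) = g (g (f y))" for y
      using fs by (auto simp: support_group_def centralizer_def fun_eq_iff)
    have fix_out: "g y = y" if "y \<notin> A" for y using that g(3) moved_in_supp[of g y] by blast
    have "g (g y) = y" for y
    proof (cases "y \<in> A")
      case True
      then have "f y \<notin> A" using A(4) by blast
      \<comment> \<open>As \<open>g\<close> fixes \<open>f y\<close>, \<open>comm\<close> gives
        \<open>f (g (g y)) = f y\<close>.\<close>
      then show ?thesis using comm[of y] fix_out G_inj[OF f] by (metis injD)
    qed (simp add: fix_out)
    then show False using g(2) by (auto simp: fun_eq_iff)
  qed
qed

section \<open>A basis made of supports of involutions\<close>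

text \<open>The support of a swap of \<open>B\<close> with its image may leave \<open>U\<close>.
  Three orbit points provide two swaps with disjoint images of \<open>B\<close>, so that the two
  supports meet exactly in \<open>B\<close>.\<close>

lemma involution_supports_base:
  assumes "open U" "x \<in> U"
  shows "\<exists>s\<in>G. \<exists>t\<in>G. s \<circ> s = id \<and> t \<circ> t = id \<and> x \<in> supp s \<inter> supp t \<and> supp s \<inter> supp t \<subseteq> U"
proof -
  have "\<exists>f\<in>G. \<exists>g\<in>G. f x \<noteq> x \<and> g x \<noteq> x \<and> f x \<noteq> g x"
  proof -
    obtain y1 y2 y3 where "y1 \<in> orbit G x" "y2 \<in> orbit G x" "y3 \<in> orbit G x"
      "y1 \<noteq> y2" "y1 \<noteq> y3" "y2 \<noteq> y3"
      using K unfolding K_LCC_def by blast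
    then show ?thesis unfolding orbit_def by auto metis
  qed
  then obtain f g where fg: "f \<in> G" "g \<in> G" "f x \<noteq> x" "g x \<noteq> x" "f x \<noteq> g x" by blast
  obtain V W where VW: "open V" "open W" "f x \<in> V" "g x \<in> W" "V \<inter> W = {}"
    using separation[OF fg(5)] by blast
  obtain A where A: "open A" "x \<in> A" "A \<subseteq> U" "f ` A \<inter> A = {}"
    using small_disjoint_image[OF fg(1,3) assms] by blast
  have "open (A \<inter> f -` V \<inter> g -` W)"
    using VW A(1) fg(1,2) homeo is_homeo_continuous
    by (metis continuous_on_open_vimage inf_top.right_neutral open_Int open_UNIV)
  then obtain B where B: "compact B" "open B" "x \<in> B" "B \<subseteq> A \<inter> f -` V \<inter> g -` W" "g ` B \<inter> B = {}"
    using small_disjoint_image[OF fg(2,4), of "A \<inter> f -` V \<inter> g -` W"] A(2) VW(3,4) by blast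
  have fB: "f ` B \<inter> B = {}" using B(4) A(4) by blast
  have "f ` B \<subseteq> V" "g ` B \<subseteq> W" using B(4) by blast+
  then have "(B \<union> f ` B) \<inter> (B \<union> g ` B) = B" using VW(5) fB B(5) by blast
  then show ?thesis
    using swap_on[OF fg(1) B(1,2) fB] swap_on[OF fg(2) B(1,2,5)] B(3,4) A(3)
    by (intro bexI[of _ "swap_on f B"] bexI[of _ "swap_on g B"]) auto
qed

lemma involution_supports_separate:
  assumes "\<And>s. s \<in> G \<Longrightarrow> s \<circ> s = id \<Longrightarrow> x \<in> supp s \<longleftrightarrow> y \<in> supp s"
  shows "x = y"
proof (rule ccontr)
  assume "x \<noteq> y"
  then show False
    using involution_supports_base[OF open_avoiding[of y], of x] assms by blast
qed

text \<open>Supports are open, so by local movement a nonempty intersection carries a nontrivial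
  element. This reduces disjointness to inclusions of supports of arbitrary elements
  \<open>r\<close>.\<close>

lemma supp_disjoint_iff:
  assumes "s \<in> G" "t \<in> G"
  shows "supp s \<inter> supp t = {} \<longleftrightarrow>
    (\<forall>r\<in>G. supp r \<subseteq> supp s \<and> supp r \<subseteq> supp t \<longrightarrow> r = id)"
  using moving[of "supp s \<inter> supp t"] open_supp assms supp_nonempty
  by (metis le_inf_iff open_Int subset_empty)

end

section \<open>Transport along an isomorphism\<close>

locale K_LCC_iso = A: K_LCC_group G + B: K_LCC_group H
  for G :: "('a::topological_space \<Rightarrow> 'a) set" and H :: "('b::topological_space \<Rightarrow> 'b) set" +
  fixes \<Phi> :: "('a \<Rightarrow> 'a) \<Rightarrow> ('b \<Rightarrow> 'b)"
  assumes bij: "bij_betw \<Phi> G H"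
    and hom: "f \<in> G \<Longrightarrow> g \<in> G \<Longrightarrow> \<Phi> (f \<circ> g) = \<Phi> f \<circ> \<Phi> g"
begin

section \<open>Preservation of commutation and of support relations\<close>

lemma image: "f \<in> G \<Longrightarrow> \<Phi> f \<in> H"
  using bij bij_betwE by blast

lemma image_eq: "\<Phi> ` G = H"
  using bij by (simp add: bij_betw_def)

lemma eq_iff: "f \<in> G \<Longrightarrow> g \<in> G \<Longrightarrow> \<Phi> f = \<Phi> g \<longleftrightarrow> f = g"
  using bij by (auto simp: bij_betw_def inj_on_eq_iff)

lemma map_id: "\<Phi> id = id"
proof -
  have "\<Phi> id \<circ> \<Phi> id = \<Phi> id" using hom[OF A.id_in A.id_in] by simp
  then show ?thesis
    using B.G_inj[OF image[OF A.id_in]] by (metis comp_apply eq_id_iff injD)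
qed

lemma map_inv:
  assumes "f \<in> G" shows "\<Phi> (inv f) = inv (\<Phi> f)"
proof -
  have "f \<circ> inv f = id" using A.G_bij[OF assms] by (simp add: bij_is_surj surj_iff[symmetric])
  then have "\<Phi> f \<circ> \<Phi> (inv f) = id" using hom[OF assms A.inv_in[OF assms]] map_id by simp
  then show ?thesis
    using B.G_bij[OF image[OF assms]] by (metis bij_is_inj inv_o_cancel comp_assoc comp_id id_comp)
qed

lemma comm_iff: "f \<in> G \<Longrightarrow> g \<in> G \<Longrightarrow> \<Phi> f \<circ> \<Phi> g = \<Phi> g \<circ> \<Phi> f \<longleftrightarrow> f \<circ> g = g \<circ> f"
  by (metis A.comp_in eq_iff hom)

lemma involution_iff: "f \<in> G \<Longrightarrow> \<Phi> f \<circ> \<Phi> f = id \<longleftrightarrow> f \<circ> f = id"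
  by (metis A.comp_in A.id_in eq_iff hom map_id)

lemma centralizer_subset: "centralizer G S \<subseteq> G"
  by (auto simp: centralizer_def)

lemma image_centralizer:
  assumes "S \<subseteq> G" shows "\<Phi> ` centralizer G S = centralizer H (\<Phi> ` S)"
proof -
  have "f \<in> centralizer G S \<longleftrightarrow> \<Phi> f \<in> centralizer H (\<Phi> ` S)" if "f \<in> G" for f
    using that image comm_iff[OF that subsetD[OF assms]] by (simp add: centralizer_def)
  moreover have "centralizer H (\<Phi> ` S) \<subseteq> \<Phi> ` G" by (auto simp: image_eq centralizer_def)
  ultimately show ?thesis using centralizer_subset[of S] by blast
qed

lemma image_self_commuting:
  assumes p: "p \<in> G"
  shows "\<Phi> ` self_commuting_involutions G p = self_commuting_involutions H (\<Phi> p)"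
proof -
  have C: "centralizer H {\<Phi> p} = \<Phi> ` centralizer G {p}" using image_centralizer[of "{p}"] p by simp
  have *: "\<Phi> f \<circ> (\<Phi> g \<circ> \<Phi> f \<circ> inv (\<Phi> g)) = (\<Phi> g \<circ> \<Phi> f \<circ> inv (\<Phi> g)) \<circ> \<Phi> f \<longleftrightarrow>
      f \<circ> (g \<circ> f \<circ> inv g) = (g \<circ> f \<circ> inv g) \<circ> f" if "f \<in> G" "g \<in> G" for f g
    using comm_iff[of f "g \<circ> f \<circ> inv g"] that by (simp add: A.comp_in A.inv_in hom map_inv)
  have "f \<in> self_commuting_involutions G p \<longleftrightarrow> \<Phi> f \<in> self_commuting_involutions H (\<Phi> p)"
    if f: "f \<in> G" for f
  proof -
    have "\<Phi> f \<in> \<Phi> ` centralizer G {p} \<longleftrightarrow> f \<in> centralizer G {p}"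
      using f eq_iff centralizer_subset by blast
    then show ?thesis
      unfolding self_commuting_involutions_def C
      using f involution_iff[OF f] *[OF f] centralizer_subset[of "{p}"] by (auto 4 4)
  qed
  moreover have "self_commuting_involutions H (\<Phi> p) \<subseteq> \<Phi> ` G"
    by (auto simp: image_eq self_commuting_involutions_def centralizer_def)
  moreover have "self_commuting_involutions G p \<subseteq> G"
    by (auto simp: self_commuting_involutions_def centralizer_def)
  ultimately show ?thesis by blast
qed

lemma image_support_group:
  assumes p: "p \<in> G"
  shows "\<Phi> ` support_group G p = support_group H (\<Phi> p)"
proof -
  let ?V = "centralizer G (self_commuting_involutions G p)"
  have "self_commuting_involutions G p \<subseteq> G"
    by (auto simp: self_commuting_involutions_def centralizer_def)
  then have V: "\<Phi> ` ?V = centralizer H (self_commuting_involutions H (\<Phi> p))"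
    by (simp add: image_centralizer image_self_commuting p)
  have "?V \<subseteq> G" by (rule centralizer_subset)
  then have "\<Phi> ` (\<lambda>f. f \<circ> f) ` ?V = (\<lambda>f. f \<circ> f) ` \<Phi> ` ?V" "(\<lambda>f. f \<circ> f) ` ?V \<subseteq> G"
    using hom A.comp_in by (auto simp: image_image subset_iff intro!: image_cong)
  then show ?thesis unfolding support_group_def by (simp add: image_centralizer V)
qed

lemma supp_subset_transport:
  assumes "p \<in> G" "p \<circ> p = id" "f \<in> G"
  shows "supp (\<Phi> f) \<subseteq> supp (\<Phi> p) \<longleftrightarrow> supp f \<subseteq> supp p"
proof -
  have "support_group G p \<subseteq> G" by (simp add: support_group_def centralizer_subset)
  then have "\<Phi> f \<in> \<Phi> ` support_group G p \<longleftrightarrow> f \<in> support_group G p"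
    using assms(3) eq_iff by blast
  then show ?thesis
    using A.support_group_iff[OF assms] B.support_group_iff[of "\<Phi> p" "\<Phi> f"] assms
      involution_iff image image_support_group by simp
qed

lemma supp_disjoint_transport:
  assumes "s \<in> G" "s \<circ> s = id" "t \<in> G" "t \<circ> t = id"
  shows "supp (\<Phi> s) \<inter> supp (\<Phi> t) = {} \<longleftrightarrow> supp s \<inter> supp t = {}"
proof -
  have "\<Phi> r = id \<longleftrightarrow> r = id" if "r \<in> G" for r
    using eq_iff[OF that A.id_in] by (simp add: map_id)
  then have "(\<forall>r\<in>H. supp r \<subseteq> supp (\<Phi> s) \<and> supp r \<subseteq> supp (\<Phi> t) \<longrightarrow> r = id) \<longleftrightarrow>
    (\<forall>r\<in>G. supp r \<subseteq> supp s \<and> supp r \<subseteq> supp t \<longrightarrow> r = id)"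
    unfolding image_eq[symmetric] ball_simps
    by (intro ball_cong) (simp_all add: supp_subset_transport assms)
  then show ?thesis using A.supp_disjoint_iff B.supp_disjoint_iff assms image by simp
qed

section \<open>The induced correspondence of points\<close>

definition corresponds :: "'a \<Rightarrow> 'b \<Rightarrow> bool" where
  "corresponds x y \<longleftrightarrow> (\<forall>s\<in>G. s \<circ> s = id \<longrightarrow> (y \<in> supp (\<Phi> s) \<longleftrightarrow> x \<in> supp s))"

text \<open>The finite intersection property is applied inside one compact support. Finitely many
  conditions on \<open>x\<close> hold on an open neighbourhood; an involution supported there has an
  image whose support satisfies all the transported conditions.\<close>

lemma exists_corresponding: "\<exists>y. corresponds x y"
proof -
  define P where "P = {s \<in> G. s \<circ> s = id \<and> x \<in> supp s}"
  define N where "N = {s \<in> G. s \<circ> s = id \<and> x \<notin> supp s}"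
  \<comment> \<open>The space need not be compact; \<open>supp (\<Phi> p)\<close> serves as the
    compact set.\<close>
  obtain p where p: "p \<in> P"
    using A.involution_supports_base[OF open_UNIV, of x] unfolding P_def by blast
  define C where "C s = (if s \<in> P then supp (\<Phi> s) else - supp (\<Phi> s))" for s
  have finite_meets: "supp (\<Phi> p) \<inter> (\<Inter>s\<in>F. C s) \<noteq> {}" if F: "finite F" "F \<subseteq> P \<union> N" for F
  proof -
    define W where "W = (\<Inter>s\<in>insert p F. if s \<in> P then supp s else - supp s)"
    have "open W"
      unfolding W_def using F p A.open_supp closed_supp
      by (intro open_INT) (auto simp: P_def open_Compl)
    moreover have "x \<in> W" unfolding W_def using p F(2) by (auto simp: P_def N_def)
    ultimately obtain r where r: "r \<in> G" "r \<circ> r = id" "r \<noteq> id" "supp r \<subseteq> W"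
      using A.involution_inside by blast
    have "\<Phi> r \<noteq> id" using r A.id_in eq_iff map_id by metis
    \<comment> \<open>Any point of \<open>supp (\<Phi> r)\<close> is a witness: membership
      conditions follow from transported inclusion, the others from transported
      disjointness.\<close>
    then obtain z where z: "z \<in> supp (\<Phi> r)" using supp_nonempty by blast
    have "z \<in> C s" if s: "s \<in> insert p F" for s
    proof (cases "s \<in> P")
      case True
      then have "supp r \<subseteq> supp s" using r(4) s unfolding W_def by auto
      then have "supp (\<Phi> r) \<subseteq> supp (\<Phi> s)"
        using True r by (simp add: supp_subset_transport P_def)
      then show ?thesis using z True unfolding C_def by auto
    next
      case False
      then have sN: "s \<in> N" using s F p by blast
      have "supp r \<inter> supp s = {}" using False r(4) s unfolding W_def by auto
      then have "supp (\<Phi> r) \<inter> supp (\<Phi> s) = {}"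
        using sN r by (simp add: supp_disjoint_transport N_def)
      then show ?thesis using z False unfolding C_def by auto
    qed
    then have "z \<in> C p" "z \<in> (\<Inter>s\<in>F. C s)" by blast+
    then show ?thesis using p by (metis C_def IntI emptyE)
  qed
  have "supp (\<Phi> p) \<inter> (\<Inter>s\<in>P \<union> N. C s) \<noteq> {}"
  proof (rule compact_imp_fip_image)
    show "compact (supp (\<Phi> p))" using p B.compact_supp image unfolding P_def by blast
    \<comment> \<open>Supports are both open and closed, so the complements are closed as
      well.\<close>
    show "closed (C s)" if "s \<in> P \<union> N" for s
      using that B.open_supp image closed_supp unfolding C_def P_def N_def by auto
  qed (use finite_meets in auto)
  then obtain y where y: "y \<in> C s" if "s \<in> P \<union> N" for s by auto
  have "corresponds x y"
    unfolding corresponds_def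
  proof (intro ballI impI)
    fix s assume "s \<in> G" "s \<circ> s = id"
    then show "y \<in> supp (\<Phi> s) \<longleftrightarrow> x \<in> supp s"
      using y[of s] unfolding C_def P_def N_def by (auto split: if_splits)
  qed
  then show ?thesis ..
qed

lemma corresponds_unique_right: "corresponds x y \<Longrightarrow> corresponds x z \<Longrightarrow> y = z"
  by (rule B.involution_supports_separate)
    (auto simp: corresponds_def image_eq[symmetric] involution_iff)

lemma corresponds_unique_left: "corresponds x z \<Longrightarrow> corresponds y z \<Longrightarrow> x = y"
  by (rule A.involution_supports_separate) (auto simp: corresponds_def)

text \<open>Testing \<open>g x\<close> against \<open>s\<close> amounts to testing \<open>x\<close>
  against the conjugate \<open>inv g \<circ> s \<circ> g\<close>, again an involution of
  \<open>G\<close>.\<close>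

lemma corresponds_equivariant:
  assumes g: "g \<in> G" and xy: "corresponds x y"
  shows "corresponds (g x) (\<Phi> g y)"
  unfolding corresponds_def
proof (intro ballI impI)
  fix s assume s: "s \<in> G" "s \<circ> s = id"
  let ?t = "inv g \<circ> s \<circ> g"
  have t: "?t \<in> G" using g s by (simp add: A.comp_in A.inv_in)
  have "?t \<circ> ?t = id"
    using s(2) A.G_bij[OF g] by (simp add: fun_eq_iff bij_is_surj surj_f_inv_f bij_is_inj)
  then have "y \<in> supp (\<Phi> ?t) \<longleftrightarrow> x \<in> supp ?t" using xy t by (simp add: corresponds_def)
  moreover have "\<Phi> ?t = inv (\<Phi> g) \<circ> \<Phi> s \<circ> \<Phi> g"
    using g s by (simp add: hom map_inv A.comp_in A.inv_in)
  ultimately show "\<Phi> g y \<in> supp (\<Phi> s) \<longleftrightarrow> g x \<in> supp s"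
    using supp_conjugate_mem A.homeo[OF g] B.homeo[OF image[OF g]] by metis
qed

text \<open>The preimage of a basic set \<open>supp s \<inter> supp t\<close> is the open set
  \<open>supp (\<Phi> s) \<inter> supp (\<Phi> t)\<close>.\<close>

lemma corresponds_continuous:
  assumes "\<And>y. corresponds (h y) y"
  shows "continuous_on UNIV h"
proof (subst continuous_on_open_vimage[OF open_UNIV], intro allI impI)
  fix U :: "'a set" assume U: "open U"
  have "open (h -` U)"
  proof (rule iffD2[OF open_subopen], intro ballI)
    fix y assume "y \<in> h -` U"
    then obtain s t where st: "s \<in> G" "t \<in> G" "s \<circ> s = id" "t \<circ> t = id"
      "h y \<in> supp s \<inter> supp t" "supp s \<inter> supp t \<subseteq> U"
      using A.involution_supports_base[OF U] by blast
    have "z \<in> supp (\<Phi> s) \<inter> supp (\<Phi> t) \<longleftrightarrow> h z \<in> supp s \<inter> supp t" for z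
      using assms[of z] st(1-4) by (simp add: corresponds_def)
    then show "\<exists>T. open T \<and> y \<in> T \<and> T \<subseteq> h -` U"
      using st B.open_supp image
      by (intro exI[of _ "supp (\<Phi> s) \<inter> supp (\<Phi> t)"]) (auto intro!: open_Int)
  qed
  then show "open (h -` U \<inter> UNIV)" by simp
qed

text \<open>Through this symmetry, existence of corresponding points and continuity are available in
  both directions.\<close>

lemma iso_inverse: "K_LCC_iso H G (the_inv_into G \<Phi>)"
proof unfold_locales
  have i: "inj_on \<Phi> G" using bij by (simp add: bij_betw_def)
  show "bij_betw (the_inv_into G \<Phi>) H G" using bij by (rule bij_betw_the_inv_into)
  fix f g assume "f \<in> H" "g \<in> H"
  then obtain a b where "a \<in> G" "b \<in> G" "f = \<Phi> a" "g = \<Phi> b"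
    unfolding image_eq[symmetric] by blast
  then show "the_inv_into G \<Phi> (f \<circ> g) = the_inv_into G \<Phi> f \<circ> the_inv_into G \<Phi> g"
    using i by (metis A.comp_in hom the_inv_into_f_f)
qed

lemma corresponds_inverse: "K_LCC_iso.corresponds H (the_inv_into G \<Phi>) y x \<longleftrightarrow> corresponds x y"
proof -
  have "the_inv_into G \<Phi> (\<Phi> s) = s" if "s \<in> G" for s
    using bij that by (simp add: bij_betw_def the_inv_into_f_f)
  then show ?thesis
    unfolding corresponds_def K_LCC_iso.corresponds_def[OF iso_inverse]
    by (auto simp: image_eq[symmetric] involution_iff)
qed

theorem spatial_realization:
  "\<exists>\<phi> \<psi>. homeomorphism UNIV UNIV \<phi> \<psi> \<and> (\<forall>\<gamma>\<in>G. \<Phi> \<gamma> = \<phi> \<circ> \<gamma> \<circ> \<psi>)"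
proof -
  interpret I: K_LCC_iso H G "the_inv_into G \<Phi>" by (rule iso_inverse)
  obtain \<phi> where \<phi>: "corresponds x (\<phi> x)" for x
    using exists_corresponding by metis
  obtain \<psi> where \<psi>: "corresponds (\<psi> y) y" for y
    using I.exists_corresponding corresponds_inverse by metis
  have "\<psi> (\<phi> x) = x" for x using \<phi> \<psi> corresponds_unique_left by blast
  moreover have \<phi>\<psi>: "\<phi> (\<psi> y) = y" for y using \<phi> \<psi> corresponds_unique_right by blast
  moreover have "continuous_on UNIV \<psi>" by (rule corresponds_continuous[OF \<psi>])
  moreover have "continuous_on UNIV \<phi>"
    using \<phi> by (intro I.corresponds_continuous) (simp add: corresponds_inverse)
  ultimately have "homeomorphism UNIV UNIV \<phi> \<psi>"
    by (simp add: homeomorphism_def surj_def) metis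
  \<comment> \<open>Both sides correspond to the point \<open>\<gamma> (\<psi> y)\<close>, so
    uniqueness identifies them.\<close>
  moreover have "\<Phi> \<gamma> y = \<phi> (\<gamma> (\<psi> y))" if "\<gamma> \<in> G" for \<gamma> y
    using corresponds_equivariant[OF that \<psi>] \<phi> corresponds_unique_right by blast
  ultimately show ?thesis by (auto simp: fun_eq_iff)
qed

end

theorem theorem6p19:
  fixes G1 :: "('a::topological_space \<Rightarrow> 'a) set"
    and G2 :: "('b::topological_space \<Rightarrow> 'b) set"
    and \<Phi> :: "('a \<Rightarrow> 'a) \<Rightarrow> ('b \<Rightarrow> 'b)"
  assumes "K_LCC G1" and "K_LCC G2"
    and "bij_betw \<Phi> G1 G2"
    and "\<forall>f\<in>G1. \<forall>g\<in>G1. \<Phi> (f \<circ> g) = \<Phi> f \<circ> \<Phi> g"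
  shows "\<exists>\<phi> \<psi>. homeomorphism UNIV UNIV \<phi> \<psi> \<and> (\<forall>\<gamma>\<in>G1. \<Phi> \<gamma> = \<phi> \<circ> \<gamma> \<circ> \<psi>)"
proof -
  interpret K_LCC_iso G1 G2 \<Phi>
    using assms by unfold_locales auto
  show ?thesis by (rule spatial_realization)
qed

end
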